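(* Let $k$ be a positive integer with $2k\ge 3$. If $G$ is a minimal $2k$-cross-theta that is a balanced subdivision of an $L_{2k}$ with $k$ entrant and $k$ salient arrows, then $G$ is minimally dependent over every field.
   Context: An oriented hypergraph is a quintuple $G=(V,E,I,\iota,\sigma)$ with finite sets of vertices $V$, edges $E$, incidences $I$, an incidence function $\iota:I\to V\times E$ (not necessarily injective), and an orientation $\sigma:I\to\{+1,-1\}$; an incidence with $\sigma=+1$ is an entrant arrow and one with $\sigma=-1$ is a salient arrow. The incidence matrix is the $V\times E$ matrix whose $(v,e)$-entry is the sum of $\sigma(i)$ over all $i$ with $\iota(i)=(v,e)$. $G$ is minimally dependent over a field if the columns of the incidence matrix, with entries regarded in that field, are linearly dependent but every proper subset of columns is linearly independent. A path of length $n/2$ is a non-repeating sequence $(a_0,i_1,a_1,\dots,i_n,a_n)$, where the $a_j$ alternate between vertices and edges and $i_j$ is an incidence between $a_{j-1}$ and $a_j$. A circle is a closed path. The sign of a circle with $n$ incidences is $(-1)^{\lfloor n/2\rfloor}\prod_{j=1}^n\sigma(i_j)$. An $m$-cross-theta ($m\ge3$) consists of $m$ internally disjoint paths of half-integer length with common end-points (one a vertex, one an edge); it is minimal if it consists of exactly these $m$ paths and nothing else. $L_m$ is the hypergraph with a single vertex, a single edge and $m$ incidences between them. A subdivision of an edge $e$ replaces $e$ by two edges $e_1,e_2$, a new vertex $w$ and two new incidences $j_1,j_2$ at $w$ with $j_1\in I(e_1)$, $j_2\in I(e_2)$, $I(e_1)\cap I(e_2)=\emptyset$ and $(I(e_1)\setminus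 j_1)\cup(I(e_2)\setminus j_2)=I(e)$, where $I(x)$ is the set of incidences of $x$; the term is also used for iterated subdivisions (including none). A balanced subdivision is one in which the signs of corresponding circles do not change. *)

theory Defs
  imports Complex_Main "HOL-Library.Function_Algebras"
begin

record ('v, 'e, 'i) ohypergraph =
  verts :: "'v set"
  edges :: "'e set"
  incs :: "'i set"
  inc_fun :: "'i \<Rightarrow> 'v \<times> 'e"
  orient :: "'i \<Rightarrow> int"

(* inc_fun and orient are only meaningful on incs G. *)
definition oriented_hypergraph :: "('v, 'e, 'i) ohypergraph \<Rightarrow> bool" where
  "oriented_hypergraph G \<longleftrightarrow>
     finite (verts G) \<and> finite (edges G) \<and> finite (incs G) \<and>
     inc_fun G ` incs G \<subseteq> verts G \<times> edges G \<and>
     orient G ` incs G \<subseteq> {1, -1}"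

definition entrant :: "('v, 'e, 'i) ohypergraph \<Rightarrow> 'i set" where
  "entrant G = {i \<in> incs G. orient G i = 1}"

definition salient :: "('v, 'e, 'i) ohypergraph \<Rightarrow> 'i set" where
  "salient G = {i \<in> incs G. orient G i = -1}"

definition incs_of_edge :: "('v, 'e, 'i) ohypergraph \<Rightarrow> 'e \<Rightarrow> 'i set" where
  "incs_of_edge G e = {i \<in> incs G. snd (inc_fun G i) = e}"


subsection \<open>Incidence matrix and minimal dependence\<close>

definition incidence_matrix :: "('v, 'e, 'i) ohypergraph \<Rightarrow> 'v \<Rightarrow> 'e \<Rightarrow> int" where
  "incidence_matrix G v e = (\<Sum>i | i \<in> incs G \<and> inc_fun G i = (v, e). orient G i)"

(* The field 'k enters through the result type. For an oriented hypergraph the column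
   vanishes outside verts G, so it can be read as a vector of the space of all functions. *)
definition column :: "('v, 'e, 'i) ohypergraph \<Rightarrow> 'e \<Rightarrow> 'v \<Rightarrow> 'k::field" where
  "column G e = (\<lambda>v. of_int (incidence_matrix G v e))"

global_interpretation fun_space:
  vector_space "\<lambda>(c::'k::field) (f::'v \<Rightarrow> 'k) v. c * f v"
  by unfold_locales (auto simp: fun_eq_iff algebra_simps)

(* Columns form a family indexed by edges: two equal columns are dependent, hence inj_on. *)
definition columns_independent ::
  "'k::field itself \<Rightarrow> ('v, 'e, 'i) ohypergraph \<Rightarrow> 'e set \<Rightarrow> bool" where
  "columns_independent K G F \<longleftrightarrow>
     inj_on (column G :: 'e \<Rightarrow> 'v \<Rightarrow> 'k) F \<and>
     fun_space.independent ((column G :: 'e \<Rightarrow> 'v \<Rightarrow> 'k) ` F)"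

definition minimally_dependent ::
  "'k::field itself \<Rightarrow> ('v, 'e, 'i) ohypergraph \<Rightarrow> bool" where
  "minimally_dependent K G \<longleftrightarrow>
     \<not> columns_independent K G (edges G) \<and>
     (\<forall>F. F \<subset> edges G \<longrightarrow> columns_independent K G F)"


subsection \<open>Paths and circles\<close>

(* A sequence (a_0, i_1, a_1, ..., i_n, a_n) is given by the list [a_0, ..., a_n] of
   vertices (Inl) and edges (Inr) and the list [i_1, ..., i_n] of incidences. *)
definition hwalk :: "('v, 'e, 'i) ohypergraph \<Rightarrow> ('v + 'e) list \<Rightarrow> 'i list \<Rightarrow> bool" where
  "hwalk G as is \<longleftrightarrow>
     length as = length is + 1 \<and>
     set as \<subseteq> Inl ` verts G \<union> Inr ` edges G \<and>
     set is \<subseteq> incs G \<and>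
     (\<forall>j < length is. {as ! j, as ! Suc j} =
        {Inl (fst (inc_fun G (is ! j))), Inr (snd (inc_fun G (is ! j)))})"

definition hpath :: "('v, 'e, 'i) ohypergraph \<Rightarrow> ('v + 'e) list \<Rightarrow> 'i list \<Rightarrow> bool" where
  "hpath G as is \<longleftrightarrow> hwalk G as is \<and> distinct as \<and> distinct is"

(* Non-repeating except that the two ends coincide; the list representation fixes a base
   point and a direction, neither of which affects the sign. *)
definition hcircle :: "('v, 'e, 'i) ohypergraph \<Rightarrow> ('v + 'e) list \<Rightarrow> 'i list \<Rightarrow> bool" where
  "hcircle G as is \<longleftrightarrow>
     hwalk G as is \<and> is \<noteq> [] \<and> hd as = last as \<and> distinct (tl as) \<and> distinct is"

definition circle_sign :: "('v, 'e, 'i) ohypergraph \<Rightarrow> 'i list \<Rightarrow> int" where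
  "circle_sign G is = (-1) ^ (length is div 2) * (\<Prod>i\<leftarrow>is. orient G i)"


subsection \<open>Cross-thetas\<close>

(* The paths are (A j, J j) for j < m, all written from the common end-vertex v to the
   common end-edge e. Incidences count as internal, which keeps parallel paths of
   length 1/2 apart. *)
definition cross_theta_paths ::
  "('v, 'e, 'i) ohypergraph \<Rightarrow> nat \<Rightarrow> (nat \<Rightarrow> ('v + 'e) list) \<Rightarrow> (nat \<Rightarrow> 'i list) \<Rightarrow> bool" where
  "cross_theta_paths G m A J \<longleftrightarrow> 3 \<le> m \<and>
     (\<exists>v e. (\<forall>j<m. hpath G (A j) (J j) \<and> odd (length (J j)) \<and>
                   hd (A j) = Inl v \<and> last (A j) = Inr e) \<and>
            (\<forall>j<m. \<forall>l<m. j \<noteq> l \<longrightarrow>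
                   set (A j) \<inter> set (A l) = {Inl v, Inr e} \<and> set (J j) \<inter> set (J l) = {}))"

definition minimal_cross_theta :: "nat \<Rightarrow> ('v, 'e, 'i) ohypergraph \<Rightarrow> bool" where
  "minimal_cross_theta m G \<longleftrightarrow> (\<exists>A J. cross_theta_paths G m A J \<and>
     Inl ` verts G \<union> Inr ` edges G = (\<Union>j<m. set (A j)) \<and>
     incs G = (\<Union>j<m. set (J j)))"

(* For an oriented hypergraph all incidences then join the only vertex to the only edge. *)
definition is_L :: "nat \<Rightarrow> ('v, 'e, 'i) ohypergraph \<Rightarrow> bool" where
  "is_L m G \<longleftrightarrow> oriented_hypergraph G \<and>
     card (verts G) = 1 \<and> card (edges G) = 1 \<and> card (incs G) = m"


subsection \<open>Subdivisions\<close>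

(* One of the new edges may reuse the name e, which makes the notion insensitive to the
   supply of names. Old incidences keep their vertex and their orientation. *)
definition edge_subdivision ::
  "('v, 'e, 'i) ohypergraph \<Rightarrow> ('v, 'e, 'i) ohypergraph \<Rightarrow> bool" where
  "edge_subdivision H G \<longleftrightarrow> oriented_hypergraph H \<and> oriented_hypergraph G \<and>
     (\<exists>e e1 e2 w j1 j2.
        e \<in> edges H \<and>
        e1 \<noteq> e2 \<and> e1 \<notin> edges H - {e} \<and> e2 \<notin> edges H - {e} \<and>
        w \<notin> verts H \<and>
        j1 \<noteq> j2 \<and> j1 \<notin> incs H \<and> j2 \<notin> incs H \<and>
        verts G = insert w (verts H) \<and>
        edges G = insert e1 (insert e2 (edges H - {e})) \<and>
        incs G = insert j1 (insert j2 (incs H)) \<and>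
        inc_fun G j1 = (w, e1) \<and> inc_fun G j2 = (w, e2) \<and>
        (\<forall>i \<in> incs H. orient G i = orient H i) \<and>
        (\<forall>i \<in> incs H. fst (inc_fun G i) = fst (inc_fun H i)) \<and>
        (\<forall>i \<in> incs H - incs_of_edge H e. inc_fun G i = inc_fun H i) \<and>
        incs_of_edge G e1 \<inter> incs_of_edge G e2 = {} \<and>
        (incs_of_edge G e1 - {j1}) \<union> (incs_of_edge G e2 - {j2}) = incs_of_edge H e)"

definition subdivision ::
  "('v, 'e, 'i) ohypergraph \<Rightarrow> ('v, 'e, 'i) ohypergraph \<Rightarrow> bool" where
  "subdivision = edge_subdivision\<^sup>*\<^sup>*"

(* Subdividing keeps all old incidences. The circle of G corresponding to a circle C of H
   arises from C by inserting new incidences, so it is the one whose incidences in H are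
   exactly those of C. *)
definition balanced_subdivision ::
  "('v, 'e, 'i) ohypergraph \<Rightarrow> ('v, 'e, 'i) ohypergraph \<Rightarrow> bool" where
  "balanced_subdivision H G \<longleftrightarrow> subdivision H G \<and>
     (\<forall>as is as' is'. hcircle H as is \<longrightarrow> hcircle G as' is' \<longrightarrow>
        set is' \<inter> incs H = set is \<longrightarrow> circle_sign G is' = circle_sign H is)"

end

theory Submission
  imports Defs
begin

text \<open>Every vertex of \<open>G\<close> other than the end-vertex \<open>v\<close> has degree two, so the row of such a vertex
  determines the coordinate at one of its edges from that at the other up to sign. Hence a kernel
  vector of the incidence matrix is determined by its coordinate at the end-edge \<open>e\<close>, all its
  coordinates being \<open>\<plusminus>\<close> that one; this gives independence of proper subsets of columns over any
  field. Only the row of \<open>v\<close> remains to be checked. The vertex of \<open>L\<^sub>2\<^sub>k\<close> is the only vertex of degree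
  exceeding two, so it is \<open>v\<close>, and the incidences of \<open>L\<^sub>2\<^sub>k\<close> are the first incidences of the \<open>2k\<close>
  paths. Balance on the circle formed by two paths says that the signs propagated from \<open>e\<close> to \<open>v\<close>
  along them agree, so the row of \<open>v\<close> evaluates to \<open>\<plusminus>\<close> the sum of the orientations in \<open>L\<^sub>2\<^sub>k\<close>, which
  is \<open>k - k = 0\<close>.\<close>

section \<open>Independence of columns in terms of kernel vectors\<close>

text \<open>Injectivity moves coefficients between indices and vectors, and a repeated vector yields
  a relation of its own. This bridges independence of sets and of indexed families.\<close>

lemma (in vector_space) independent_family_iff:
  assumes "finite F"
  shows "inj_on f F \<and> independent (f ` F) \<longleftrightarrow>
    (\<forall>x. (\<Sum>a\<in>F. scale (x a) (f a)) = 0 \<longrightarrow> (\<forall>a\<in>F. x a = 0))"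
proof (intro iffI allI impI)
  fix x assume *: "inj_on f F \<and> independent (f ` F)" and 0: "(\<Sum>a\<in>F. scale (x a) (f a)) = 0"
  have "(\<Sum>b\<in>f ` F. scale (x (inv_into F f b)) b) = 0"
    using * 0 by (simp add: sum.reindex)
  then have "\<forall>b\<in>f ` F. x (inv_into F f b) = 0"
    using * \<open>finite F\<close> independentD[of "f ` F" "f ` F" "\<lambda>b. x (inv_into F f b)"] by blast
  then show "\<forall>a\<in>F. x a = 0"
    using * by simp
next
  assume *: "\<forall>x. (\<Sum>a\<in>F. scale (x a) (f a)) = 0 \<longrightarrow> (\<forall>a\<in>F. x a = 0)"
  have inj: "inj_on f F"
  proof (rule inj_onI, rule ccontr)
    fix a b assume ab: "a \<in> F" "b \<in> F" "f a = f b" "a \<noteq> b"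
    \<comment> \<open>The relation \<open>f a - f b = 0\<close>, nontrivial because
      \<open>a \<noteq> b\<close>.\<close>
    define x :: "'c \<Rightarrow> 'a" where "x c = (if c = a then 1 else if c = b then -1 else 0)" for c
    have "(\<Sum>c\<in>F. scale (x c) (f c)) = (\<Sum>c\<in>{a, b}. scale (x c) (f c))"
      using ab \<open>finite F\<close> by (intro sum.mono_neutral_right) (auto simp: x_def)
    also have "\<dots> = 0"
      using ab by (simp add: x_def)
    finally show False
      using * ab(1) by (force simp: x_def)
  qed
  have "independent (f ` F)"
  proof
    assume "dependent (f ` F)"
    then obtain u where u: "\<exists>b\<in>f ` F. u b \<noteq> 0" "(\<Sum>b\<in>f ` F. scale (u b) b) = 0"
      using dependent_finite[of "f ` F"] \<open>finite F\<close> by auto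
    then have "(\<Sum>a\<in>F. scale (u (f a)) (f a)) = 0"
      by (simp add: sum.reindex[OF inj])
    then show False
      using *[rule_format, of "\<lambda>a. u (f a)"] u(1) by auto
  qed
  with inj show "inj_on f F \<and> independent (f ` F)" by blast
qed

text \<open>The entry at \<open>w\<close> of the incidence matrix applied to \<open>x\<close>, taken
  incidence by incidence so that parallel incidences need not first be collected into matrix
  entries.\<close>

definition vertex_sum ::
  "('v, 'e, 'i) ohypergraph \<Rightarrow> ('e \<Rightarrow> 'k::field) \<Rightarrow> 'v \<Rightarrow> 'k" where
  "vertex_sum G x w =
     (\<Sum>i | i \<in> incs G \<and> fst (inc_fun G i) = w. of_int (orient G i) * x (snd (inc_fun G i)))"

text \<open>Grouping the incidences at \<open>w\<close> by their edge recovers the matrix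
  entries.\<close>

lemma sum_columns_eq_vertex_sum:
  assumes G: "oriented_hypergraph G" and F: "F \<subseteq> edges G" and x: "\<And>f. f \<notin> F \<Longrightarrow> x f = 0"
  shows "(\<Sum>f\<in>F. (\<lambda>w. x f * column G f w)) = vertex_sum G x"
proof
  fix w
  have fin: "finite (edges G)" "finite (incs G)"
    and sub: "inc_fun G ` incs G \<subseteq> verts G \<times> edges G"
    using G by (auto simp: oriented_hypergraph_def)
  have finF: "finite F"
    using F fin(1) finite_subset by blast
  have "(\<Sum>f\<in>F. (\<lambda>w. x f * column G f w)) w = (\<Sum>f\<in>F. x f * column G f w)"
    using finF by (induction F) auto
  also have "\<dots> = (\<Sum>f\<in>edges G. x f * column G f w)"
    using F fin(1) x by (intro sum.mono_neutral_left) auto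
  also have "\<dots> = (\<Sum>f\<in>edges G. \<Sum>i | i \<in> {i. i \<in> incs G \<and> fst (inc_fun G i) = w} \<and> snd (inc_fun G i) = f.
      of_int (orient G i) * x (snd (inc_fun G i)))"
    by (auto simp: column_def incidence_matrix_def sum_distrib_left prod_eq_iff conj_assoc
        intro!: sum.cong)
  also have "\<dots> = vertex_sum G x w"
    unfolding vertex_sum_def using fin sub by (intro sum.group) auto
  finally show "(\<Sum>f\<in>F. (\<lambda>w. x f * column G f w)) w = vertex_sum G x w" .
qed

text \<open>Extending coefficients by zero turns both halves of minimal dependence into statements
  about the kernel of the whole matrix: it has a nonzero vector, but none that vanishes at some
  edge.\<close>

lemma columns_independent_iff:
  fixes G :: "('v, 'e, 'i) ohypergraph"
  assumes G: "oriented_hypergraph G" and F: "F \<subseteq> edges G"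
  shows "columns_independent TYPE('k::field) G F \<longleftrightarrow>
    (\<forall>x :: 'e \<Rightarrow> 'k. (\<forall>f. f \<notin> F \<longrightarrow> x f = 0) \<longrightarrow> vertex_sum G x = 0 \<longrightarrow> x = 0)"
    (is "_ \<longleftrightarrow> ?R")
proof -
  have "finite F"
    using G F finite_subset by (auto simp: oriented_hypergraph_def)
  then have "columns_independent TYPE('k) G F \<longleftrightarrow>
    (\<forall>x :: 'e \<Rightarrow> 'k. (\<Sum>f\<in>F. (\<lambda>w. x f * column G f w)) = 0 \<longrightarrow> (\<forall>f\<in>F. x f = 0))" (is "_ \<longleftrightarrow> ?L")
    unfolding columns_independent_def by (rule fun_space.independent_family_iff)
  also have "?L \<longleftrightarrow> ?R"
  proof (intro iffI allI impI)
    fix x :: "'e \<Rightarrow> 'k" assume ?L and x: "\<forall>f. f \<notin> F \<longrightarrow> x f = 0" "vertex_sum G x = 0"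
    then have "\<forall>f\<in>F. x f = 0"
      using sum_columns_eq_vertex_sum[OF G F, of x] by simp
    with x(1) show "x = 0" by (auto simp: fun_eq_iff)
  next
    fix x :: "'e \<Rightarrow> 'k" assume R: ?R and x: "(\<Sum>f\<in>F. (\<lambda>w. x f * column G f w)) = 0"
    define x' where "x' f = (if f \<in> F then x f else 0)" for f
    have "vertex_sum G x' = (\<Sum>f\<in>F. (\<lambda>w. x' f * column G f w))"
      using sum_columns_eq_vertex_sum[OF G F, of x'] by (simp add: x'_def)
    also have "\<dots> = 0"
      using x by (simp add: x'_def cong: sum.cong)
    finally have "x' = 0"
      using R by (auto simp: x'_def)
    then show "\<forall>f\<in>F. x f = 0"
      by (auto simp: x'_def fun_eq_iff split: if_splits)
  qed
  finally show ?thesis .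
qed

section \<open>Walks: parity, concatenation and reversal\<close>

text \<open>Every incidence joins a vertex to an edge, so the kind of node flips at each
  step.\<close>

lemma hwalk_alternates:
  assumes "hwalk G as is" "hd as = Inl v" "q \<le> length is"
  shows "even q \<longleftrightarrow> isl (as ! q)"
  using assms(3)
proof (induction q)
  case 0
  then show ?case using assms(1,2) by (cases as) (auto simp: hwalk_def)
next
  case (Suc q)
  then have "{as ! q, as ! Suc q} =
    {Inl (fst (inc_fun G (is ! q))), Inr (snd (inc_fun G (is ! q)))}"
    using assms(1) by (simp add: hwalk_def)
  with Suc show ?case by (auto simp: doubleton_eq_iff)
qed

text \<open>A walk only records unordered pairs; parity decides which member is the vertex.\<close>

lemma hwalk_nth:
  assumes "hwalk G as is" "hd as = Inl v" "q < length is"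
  shows "as ! (if even q then q else Suc q) = Inl (fst (inc_fun G (is ! q)))"
    and "as ! (if even q then Suc q else q) = Inr (snd (inc_fun G (is ! q)))"
proof -
  have "{as ! q, as ! Suc q} =
    {Inl (fst (inc_fun G (is ! q))), Inr (snd (inc_fun G (is ! q)))}"
    using assms(1,3) by (simp add: hwalk_def)
  moreover have "even q \<longleftrightarrow> isl (as ! q)"
    using hwalk_alternates[OF assms(1,2)] assms(3) by simp
  ultimately show "as ! (if even q then q else Suc q) = Inl (fst (inc_fun G (is ! q)))"
    "as ! (if even q then Suc q else q) = Inr (snd (inc_fun G (is ! q)))"
    by (auto simp: doubleton_eq_iff)
qed

lemma hwalk_append:
  assumes "hwalk G as is" "hwalk G bs js" "last as = hd bs"
  shows "hwalk G (as @ tl bs) (is @ js)"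
proof -
  obtain b bs' where bs: "bs = b # bs'"
    using assms(2) by (cases bs) (auto simp: hwalk_def)
  have ne: "as \<noteq> []" and len: "length as = length is + 1" "length bs' = length js"
    using assms(1,2) bs by (auto simp: hwalk_def)
  have b: "as ! length is = b"
    using assms(3) bs ne len by (simp add: last_conv_nth)
  show ?thesis
    unfolding hwalk_def
  proof (intro conjI allI impI)
    fix q assume q: "q < length (is @ js)"
    consider "q < length is" | r where "q = length is + r" "r < length js"
      using q by (metis add_diff_inverse_nat length_append nat_add_left_cancel_less)
    then show "{(as @ tl bs) ! q, (as @ tl bs) ! Suc q} =
      {Inl (fst (inc_fun G ((is @ js) ! q))), Inr (snd (inc_fun G ((is @ js) ! q)))}"
    proof cases
      case 1
      then show ?thesis using assms(1) len by (simp add: hwalk_def nth_append)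
    next
      case (2 r)
      then have "(as @ tl bs) ! q = bs ! r" "(as @ tl bs) ! Suc q = bs ! Suc r"
        using b bs len by (auto simp: nth_append nth_Cons split: nat.splits)
      with 2 show ?thesis using assms(2) by (simp add: hwalk_def)
    qed
  qed (use assms len bs in \<open>auto simp: hwalk_def\<close>)
qed

lemma hwalk_rev:
  assumes "hwalk G as is"
  shows "hwalk G (rev as) (rev is)"
  unfolding hwalk_def
proof (intro conjI allI impI)
  fix q assume q: "q < length (rev is)"
  \<comment> \<open>Step \<open>q\<close> of the reversed walk is step \<open>r\<close> of the
    original, traversed backwards.\<close>
  define r where "r = length is - Suc q"
  have r: "r < length is" and len: "length as = length is + 1"
    using q assms by (auto simp: r_def hwalk_def)
  have "rev as ! q = as ! Suc r" "rev as ! Suc q = as ! r" "rev is ! q = is ! r"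
    using q len by (auto simp: rev_nth r_def Suc_diff_Suc)
  with r show "{rev as ! q, rev as ! Suc q} =
    {Inl (fst (inc_fun G (rev is ! q))), Inr (snd (inc_fun G (rev is ! q)))}"
    using assms by (simp add: hwalk_def insert_commute)
qed (use assms in \<open>auto simp: hwalk_def\<close>)

section \<open>Coordinates on a minimal cross-theta with its paths fixed\<close>

locale cross_theta =
  fixes G :: "('v, 'e, 'i) ohypergraph" and m :: nat
    and A :: "nat \<Rightarrow> ('v + 'e) list" and J :: "nat \<Rightarrow> 'i list" and v :: 'v and e :: 'e
  assumes oriented: "oriented_hypergraph G"
    and three_le: "3 \<le> m"
    and hpath: "\<And>j. j < m \<Longrightarrow> hpath G (A j) (J j)"
    and odd_length: "\<And>j. j < m \<Longrightarrow> odd (length (J j))"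
    and hd_A: "\<And>j. j < m \<Longrightarrow> hd (A j) = Inl v"
    and last_A: "\<And>j. j < m \<Longrightarrow> last (A j) = Inr e"
    and A_disjoint: "\<And>j l. j < m \<Longrightarrow> l < m \<Longrightarrow> j \<noteq> l \<Longrightarrow> set (A j) \<inter> set (A l) = {Inl v, Inr e}"
    and J_disjoint: "\<And>j l. j < m \<Longrightarrow> l < m \<Longrightarrow> j \<noteq> l \<Longrightarrow> set (J j) \<inter> set (J l) = {}"
    and nodes: "Inl ` verts G \<union> Inr ` edges G = (\<Union>j<m. set (A j))"
    and incs: "incs G = (\<Union>j<m. set (J j))"
begin

definition half :: "nat \<Rightarrow> nat" where
  "half j = length (J j) div 2"

text \<open>Vertices occupy the even positions of a path and edges the odd ones. Edges are numbered
  from \<open>v\<close>, so \<open>t\<close> runs from 0 to \<open>half j\<close>, the last one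
  being \<open>e\<close>.\<close>

definition edge_at :: "nat \<Rightarrow> nat \<Rightarrow> 'e" where
  "edge_at j t = projr (A j ! (2 * t + 1))"

lemma length_J: "j < m \<Longrightarrow> length (J j) = 2 * half j + 1"
  using odd_length[of j] by (simp add: half_def)

lemma hwalk: "j < m \<Longrightarrow> hwalk G (A j) (J j)"
  using hpath by (simp add: hpath_def)

lemma distinct_A: "j < m \<Longrightarrow> distinct (A j)"
  and distinct_J: "j < m \<Longrightarrow> distinct (J j)"
  using hpath by (auto simp: hpath_def)

lemma length_A: "j < m \<Longrightarrow> length (A j) = 2 * half j + 2"
  using hwalk length_J by (auto simp: hwalk_def)

lemma A_0: "j < m \<Longrightarrow> A j ! 0 = Inl v"
  using hd_A[of j] length_A[of j] by (metis hd_conv_nth length_0_conv add_is_0 zero_neq_numeral)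

lemma A_last: "j < m \<Longrightarrow> A j ! (2 * half j + 1) = Inr e"
  using last_A[of j] length_A[of j] by (metis last_conv_nth length_0_conv add_is_0 zero_neq_numeral
    add_diff_cancel_right' add_Suc_right diff_Suc_1 Suc_1 Suc_eq_plus1)

lemma A_nth:
  assumes "j < m" "q < length (J j)"
  shows "A j ! (if even q then q else Suc q) = Inl (fst (inc_fun G (J j ! q)))"
    and "A j ! (if even q then Suc q else q) = Inr (snd (inc_fun G (J j ! q)))"
  using hwalk_nth[OF hwalk hd_A] assms by blast+

lemma A_nth_edge:
  assumes "j < m" "t \<le> half j"
  shows "A j ! (2 * t + 1) = Inr (edge_at j t)"
  using A_nth(2)[of j "2 * t"] assms length_J[of j] by (simp add: edge_at_def)

lemma edge_at_half: "j < m \<Longrightarrow> edge_at j (half j) = e"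
  using A_last[of j] by (simp add: edge_at_def)

text \<open>Edge number \<open>t\<close> is entered by incidence \<open>2 * t\<close> and, before
  the end of the path, left by \<open>2 * t + 1\<close>.\<close>

lemma snd_J:
  assumes "j < m" "q < length (J j)"
  shows "snd (inc_fun G (J j ! q)) = edge_at j (q div 2)"
  using A_nth(2)[OF assms] assms length_J[of j]
  by (cases "even q") (auto simp: edge_at_def elim!: evenE oddE)

text \<open>Paths are non-repeating and internally disjoint, so only the end-edge \<open>e\<close>
  has several pairs of coordinates.\<close>

lemma edge_at_inj:
  assumes "j < m" "l < m" "t \<le> half j" "s \<le> half l" "edge_at j t = edge_at l s"
  shows "(j = l \<and> t = s) \<or> (t = half j \<and> s = half l)"
proof (cases "j = l")
  case True
  then show ?thesis
    using A_nth_edge assms nth_eq_iff_index_eq[OF distinct_A[of j], of "2 * t + 1" "2 * s + 1"]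
      length_A[of j] by auto
next
  case False
  have eq: "A j ! (2 * t + 1) = Inr (edge_at j t)" "A l ! (2 * s + 1) = Inr (edge_at j t)"
    using A_nth_edge assms by auto
  then have "Inr (edge_at j t) \<in> set (A j) \<inter> set (A l)"
    using assms length_A by (metis IntI nth_mem add_le_mono1 le_imp_less_Suc mult_le_mono2
      add_2_eq_Suc' add_Suc_right Suc_eq_plus1)
  then have "edge_at j t = e"
    using A_disjoint[OF assms(1,2) False] by auto
  with eq show ?thesis
    using A_last assms length_A nth_eq_iff_index_eq[OF distinct_A[of j], of "2 * t + 1" "2 * half j + 1"]
      nth_eq_iff_index_eq[OF distinct_A[of l], of "2 * s + 1" "2 * half l + 1"] by auto
qed

lemma edges_iff: "f \<in> edges G \<longleftrightarrow> (\<exists>j<m. Inr f \<in> set (A j))"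
proof -
  have "Inr f \<in> Inl ` verts G \<union> Inr ` edges G \<longleftrightarrow> (\<exists>j<m. Inr f \<in> set (A j))"
    unfolding nodes by auto
  then show ?thesis by auto
qed

lemma verts_iff: "w \<in> verts G \<longleftrightarrow> (\<exists>j<m. Inl w \<in> set (A j))"
proof -
  have "Inl w \<in> Inl ` verts G \<union> Inr ` edges G \<longleftrightarrow> (\<exists>j<m. Inl w \<in> set (A j))"
    unfolding nodes by auto
  then show ?thesis by auto
qed

lemma edge_at_in_edges: "j < m \<Longrightarrow> t \<le> half j \<Longrightarrow> edge_at j t \<in> edges G"
  unfolding edges_iff using A_nth_edge[of j t] length_A[of j] nth_mem[of "2 * t + 1" "A j"]
  by (intro exI[of _ j]) auto

lemma edge_cases:
  assumes "f \<in> edges G"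
  obtains j t where "j < m" "t \<le> half j" "f = edge_at j t"
proof -
  obtain j q where jq: "j < m" "q < length (A j)" "A j ! q = Inr f"
    using assms by (auto simp: edges_iff in_set_conv_nth)
  then have "odd q"
    using hwalk_alternates[OF hwalk hd_A, of j q] length_A[of j] length_J[of j] by auto
  with jq that[of j "q div 2"] length_A[of j] show ?thesis
    by (auto simp: edge_at_def elim!: oddE)
qed

lemma vert_cases:
  assumes "w \<in> verts G"
  obtains "w = v" | j t where "j < m" "t < half j" "A j ! (2 * t + 2) = Inl w"
proof -
  obtain j q where jq: "j < m" "q < length (A j)" "A j ! q = Inl w"
    using assms by (auto simp: verts_iff in_set_conv_nth)
  then have "even q"
    using hwalk_alternates[OF hwalk hd_A, of j q] length_A[of j] length_J[of j] by auto
  then obtain s where s: "q = 2 * s" by (auto elim: evenE)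
  show ?thesis
  proof (cases s)
    case 0
    then show ?thesis using that(1) jq s A_0 by simp
  next
    case (Suc t)
    then show ?thesis using that(2)[of j t] jq s length_A[of j] by auto
  qed
qed

lemma incs_cases:
  assumes "i \<in> incs G"
  obtains j q where "j < m" "q < length (J j)" "i = J j ! q"
  using assms incs by (auto simp: in_set_conv_nth)

lemma J_in_incs: "j < m \<Longrightarrow> q < length (J j) \<Longrightarrow> J j ! q \<in> incs G"
  using incs nth_mem[of q "J j"] by blast

text \<open>The vertex of incidence \<open>q\<close> sits at position \<open>q\<close> or
  \<open>Suc q\<close>, whichever is even, and \<open>v\<close> occurs only at position 0.\<close>

lemma fst_J_eq_v_iff:
  assumes "j < m" "q < length (J j)"
  shows "fst (inc_fun G (J j ! q)) = v \<longleftrightarrow> q = 0"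
proof -
  have "fst (inc_fun G (J j ! q)) = v \<longleftrightarrow> A j ! (if even q then q else Suc q) = A j ! 0"
    using A_nth(1)[OF assms] A_0[OF assms(1)] by simp
  also have "\<dots> \<longleftrightarrow> (if even q then q else Suc q) = 0"
    using assms length_A[of j] length_J[of j] by (subst nth_eq_iff_index_eq[OF distinct_A]) auto
  also have "\<dots> \<longleftrightarrow> q = 0"
    by (cases q) auto
  finally show ?thesis .
qed

lemma incs_at_v: "{i \<in> incs G. fst (inc_fun G i) = v} = (\<lambda>j. J j ! 0) ` {..<m}"
proof (intro equalityI subsetI)
  fix i assume "i \<in> {i \<in> incs G. fst (inc_fun G i) = v}"
  then obtain j q where "j < m" "q < length (J j)" "i = J j ! q" "fst (inc_fun G i) = v"
    by (auto elim: incs_cases)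
  then show "i \<in> (\<lambda>j. J j ! 0) ` {..<m}"
    using fst_J_eq_v_iff[of j q] by auto
next
  fix i assume "i \<in> (\<lambda>j. J j ! 0) ` {..<m}"
  then obtain j where "j < m" "i = J j ! 0" by auto
  then show "i \<in> {i \<in> incs G. fst (inc_fun G i) = v}"
    using fst_J_eq_v_iff[of j 0] J_in_incs[of j 0] length_J[of j] by simp
qed

lemma inj_on_J_0: "inj_on (\<lambda>j. J j ! 0) {..<m}"
  using J_disjoint length_J by (auto simp: inj_on_def)
    (metis disjoint_iff nth_mem zero_less_Suc Suc_eq_plus1)

text \<open>An inner vertex lies on a single path at a single position, so only the incidences just
  before and just after it remain: its degree is two.\<close>

lemma incs_at_inner:
  assumes "j < m" "t < half j" "A j ! (2 * t + 2) = Inl w"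
  shows "{i \<in> incs G. fst (inc_fun G i) = w} = {J j ! (2 * t + 1), J j ! (2 * t + 2)}"
proof (intro equalityI subsetI)
  fix i assume "i \<in> {i \<in> incs G. fst (inc_fun G i) = w}"
  then obtain l q where lq: "l < m" "q < length (J l)" "i = J l ! q" and w: "fst (inc_fun G i) = w"
    by (auto elim: incs_cases)
  define r where "r = (if even q then q else Suc q)"
  have A: "A l ! r = Inl w" and r: "r < length (A l)"
    using A_nth(1)[OF lq(1,2)] lq w length_A[of l] length_J[of l] by (auto simp: r_def)
  have t: "2 * t + 2 < length (A j)"
    using assms length_A by simp
  have "l = j"
  proof (rule ccontr)
    assume "l \<noteq> j"
    moreover have "Inl w \<in> set (A j) \<inter> set (A l)"
      using A r t assms(3) by (metis IntI nth_mem)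
    \<comment> \<open>A vertex shared by two paths can only be the end-vertex
      \<open>v\<close>.\<close>
    ultimately have "A j ! (2 * t + 2) = A j ! 0"
      using A_disjoint[of j l] lq(1) assms A_0 by auto
    then show False
      using t assms(1) by (subst (asm) nth_eq_iff_index_eq[OF distinct_A]) auto
  qed
  then have "r = 2 * t + 2"
    using A r t assms nth_eq_iff_index_eq[OF distinct_A] by metis
  then show "i \<in> {J j ! (2 * t + 1), J j ! (2 * t + 2)}"
    using lq \<open>l = j\<close> by (auto simp: r_def split: if_splits)
next
  fix i assume "i \<in> {J j ! (2 * t + 1), J j ! (2 * t + 2)}"
  then show "i \<in> {i \<in> incs G. fst (inc_fun G i) = w}"
    using A_nth(1)[of j "2 * t + 1"] A_nth(1)[of j "2 * t + 2"] assms length_J[of j] J_in_incs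
    by auto
qed

section \<open>Rows of the incidence matrix and the kernel\<close>

lemma vertex_sum_v:
  "vertex_sum G x v = (\<Sum>j<m. of_int (orient G (J j ! 0)) * x (edge_at j 0))"
  unfolding vertex_sum_def incs_at_v
  using snd_J length_J by (subst sum.reindex[OF inj_on_J_0]) (auto intro!: sum.cong)

lemma vertex_sum_inner:
  assumes "j < m" "t < half j" "A j ! (2 * t + 2) = Inl w"
  shows "vertex_sum G x w =
    of_int (orient G (J j ! (2 * t + 1))) * x (edge_at j t) +
    of_int (orient G (J j ! (2 * t + 2))) * x (edge_at j (Suc t))"
proof -
  have "J j ! (2 * t + 1) \<noteq> J j ! (2 * t + 2)"
    using assms length_J[of j] by (subst nth_eq_iff_index_eq[OF distinct_J]) auto
  then show ?thesis
    unfolding vertex_sum_def incs_at_inner[OF assms]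
    using snd_J[of j "2 * t + 1"] snd_J[of j "2 * t + 2"] assms length_J[of j] by simp
qed

lemma orient_J: "j < m \<Longrightarrow> q < length (J j) \<Longrightarrow> orient G (J j ! q) \<in> {1, -1}"
  using oriented J_in_incs by (fastforce simp: oriented_hypergraph_def)

text \<open>Row reduction along path \<open>j\<close>, starting at the end-edge \<open>e\<close>: in every kernel vector the
  coordinate at \<open>edge_at j t\<close> is \<open>tail_sign j t\<close> times the coordinate at \<open>e\<close>.\<close>

definition tail_sign :: "nat \<Rightarrow> nat \<Rightarrow> int" where
  "tail_sign j t = (-1) ^ (half j - t) * (\<Prod>q = 2 * t + 1..<length (J j). orient G (J j ! q))"

lemma tail_sign_half: "j < m \<Longrightarrow> tail_sign j (half j) = 1"
  using length_J[of j] by (simp add: tail_sign_def)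

text \<open>This is the recurrence obtained by solving the two-term row of an inner vertex; the
  minus sign comes from moving one term across.\<close>

lemma tail_sign_step:
  assumes "j < m" "t < half j"
  shows "tail_sign j t =
    - orient G (J j ! (2 * t + 1)) * orient G (J j ! (2 * t + 2)) * tail_sign j (Suc t)"
proof -
  have "half j - t = Suc (half j - Suc t)"
    using assms(2) by simp
  moreover have "{2 * t + 1..<length (J j)} =
      insert (2 * t + 1) (insert (2 * t + 2) {2 * Suc t + 1..<length (J j)})"
    using assms length_J[of j] by auto
  ultimately show ?thesis
    by (simp add: tail_sign_def)
qed

lemma tail_sign_cases: "j < m \<Longrightarrow> tail_sign j t \<in> {1, -1}"
proof -
  assume j: "j < m"
  have "(\<Prod>q\<in>Q. orient G (J j ! q)) \<in> {1, -1}" if "Q \<subseteq> {..<length (J j)}" for Q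
    using finite_subset[OF that finite_lessThan] that
  proof (induction Q)
    case (insert q Q)
    then show ?case using orient_J[OF j, of q] by auto
  qed simp
  then have "(\<Prod>q = 2 * t + 1..<length (J j). orient G (J j ! q)) \<in> {1, -1}"
    by (simp add: subset_eq)
  then show ?thesis
    unfolding tail_sign_def by (cases "even (half j - t)") auto
qed

text \<open>Induction from \<open>half j\<close> downwards, that is, from \<open>e\<close> towards
  \<open>v\<close>, solving one inner row per step.\<close>

lemma kernel_edge_at:
  fixes x :: "'e \<Rightarrow> 'k::field"
  assumes "j < m" "t \<le> half j" and 0: "vertex_sum G x = 0"
  shows "x (edge_at j t) = of_int (tail_sign j t) * x e"
  using assms(2)
proof (induction t rule: inc_induct)
  case base
  then show ?case using assms(1) by (simp add: edge_at_half tail_sign_half)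
next
  case (step t)
  let ?a = "orient G (J j ! (2 * t + 1))" and ?b = "orient G (J j ! (2 * t + 2))"
  have a: "?a = 1 \<or> ?a = -1"
    using orient_J[of j "2 * t + 1"] assms(1) step length_J[of j] by auto
  obtain w where "A j ! (2 * t + 2) = Inl w"
    using A_nth(1)[of j "2 * t + 2"] assms(1) step length_J[of j] by auto
  then have "of_int ?a * x (edge_at j t) + of_int ?b * x (edge_at j (Suc t)) = 0"
    using vertex_sum_inner[of j t w x] assms(1) step 0 by (simp add: fun_eq_iff)
  moreover have "x (edge_at j (Suc t)) = of_int (tail_sign j (Suc t)) * x e"
    using step by simp
  ultimately have ax: "of_int ?a * x (edge_at j t) = - (of_int ?b * (of_int (tail_sign j (Suc t)) * x e))"
    by (simp add: eq_neg_iff_add_eq_0)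
  \<comment> \<open>Multiplying by \<open>?a\<close> inverts it, since its square is 1 in every
    field.\<close>
  have "x (edge_at j t) = of_int ?a * (of_int ?a * x (edge_at j t))"
    using a by (elim disjE) (simp_all only: of_int_1 of_int_minus mult_1 mult_minus_left minus_minus)
  also have "\<dots> = of_int (- ?a * ?b * tail_sign j (Suc t)) * x e"
    unfolding ax of_int_mult of_int_minus by (simp only: mult.assoc mult_minus_left mult_minus_right)
  also have "- ?a * ?b * tail_sign j (Suc t) = tail_sign j t"
    using tail_sign_step[of j t] assms(1) step by simp
  finally show ?case .
qed

text \<open>The signs define a function on edges: the only edge with several coordinates is
  \<open>e\<close>, where every path assigns 1. \<open>inv_into\<close> picks one pair of
  coordinates per edge.\<close>

lemma exists_edge_weights:
  "\<exists>y :: 'e \<Rightarrow> 'k::field. \<forall>j<m. \<forall>t\<le>half j. y (edge_at j t) = of_int (tail_sign j t)"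
proof -
  let ?P = "SIGMA j:{..<m}. {..half j}"
  let ?g = "case_prod edge_at"
  have "tail_sign j t = case_prod tail_sign (inv_into ?P ?g (edge_at j t))"
    if "j < m" "t \<le> half j" for j t
  proof -
    obtain l s where ls: "inv_into ?P ?g (edge_at j t) = (l, s)" by fastforce
    have im: "edge_at j t \<in> ?g ` ?P"
      using that by force
    have "l < m" "s \<le> half l" "edge_at l s = edge_at j t"
      using inv_into_into[OF im] f_inv_into_f[OF im] unfolding ls by auto
    then show ?thesis
      using edge_at_inj[of l j s t] that ls tail_sign_half by auto
  qed
  then show ?thesis
    by (intro exI[of _ "\<lambda>f. of_int (case_prod tail_sign (inv_into ?P ?g f))"]) auto
qed

text \<open>The hypothesis is the row of \<open>v\<close> evaluated at the propagated signs. It is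
  an identity of integers, so it survives in every field.\<close>

lemma minimally_dependent:
  assumes 0: "(\<Sum>j<m. orient G (J j ! 0) * tail_sign j 0) = 0"
  shows "minimally_dependent TYPE('k::field) G"
  unfolding minimally_dependent_def
proof (intro conjI allI impI)
  obtain y :: "'e \<Rightarrow> 'k" where y: "\<And>j t. j < m \<Longrightarrow> t \<le> half j \<Longrightarrow> y (edge_at j t) = of_int (tail_sign j t)"
    using exists_edge_weights by blast
  \<comment> \<open>The cut-off outside \<open>edges G\<close> gives the support that the kernel
    criterion asks for.\<close>
  define y' where "y' f = (if f \<in> edges G then y f else 0)" for f
  have y': "y' (edge_at j t) = of_int (tail_sign j t)" if "j < m" "t \<le> half j" for j t
    using y edge_at_in_edges that by (simp add: y'_def)
  have "vertex_sum G y' w = 0" for w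
  proof (cases "w \<in> verts G")
    case False
    then have "{i \<in> incs G. fst (inc_fun G i) = w} = {}"
      using oriented by (force simp: oriented_hypergraph_def)
    then show ?thesis by (simp only: vertex_sum_def sum.empty)
  next
    case True
    then show ?thesis
    proof (cases rule: vert_cases)
      case 1
      have "vertex_sum G y' v = of_int (\<Sum>j<m. orient G (J j ! 0) * tail_sign j 0)"
        by (simp add: vertex_sum_v y')
      then show ?thesis using 1 0 by simp
    next
      case (2 j t)
      have "orient G (J j ! (2 * t + 1)) \<in> {1, -1}"
        using orient_J 2 length_J[of j] by simp
      then show ?thesis
        using vertex_sum_inner[OF 2, of y'] 2 y'[of j t] y'[of j "Suc t"] tail_sign_step[of j t]
        by auto
    qed
  qed
  then have "vertex_sum G y' = 0" by (simp add: fun_eq_iff)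
  \<comment> \<open>The value 1 is nonzero in any characteristic.\<close>
  moreover have "y' e = 1"
    using y'[of 0 "half 0"] three_le edge_at_half[of 0] tail_sign_half[of 0] by simp
  then have "y' \<noteq> 0"
    by (metis zero_fun_apply zero_neq_one)
  moreover have "\<forall>f. f \<notin> edges G \<longrightarrow> y' f = 0"
    by (simp add: y'_def)
  ultimately show "\<not> columns_independent TYPE('k) G (edges G)"
    using columns_independent_iff[OF oriented order.refl] by blast
next
  fix F assume F: "F \<subset> edges G"
  show "columns_independent TYPE('k) G F"
    unfolding columns_independent_iff[OF oriented psubset_imp_subset[OF F]]
  proof (intro allI impI)
    fix x :: "'e \<Rightarrow> 'k" assume x: "\<forall>f. f \<notin> F \<longrightarrow> x f = 0" "vertex_sum G x = 0"
    obtain g where g: "g \<in> edges G" "g \<notin> F"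
      using F by blast
    then obtain j t where "j < m" "t \<le> half j" "g = edge_at j t"
      using edge_cases by blast
    \<comment> \<open>The omitted coordinate is plus or minus \<open>x e\<close>, so
      \<open>x e\<close> vanishes, and every other coordinate with it.\<close>
    then have "x e = 0"
      using kernel_edge_at[OF _ _ x(2)] tail_sign_cases[of j t] x(1) g by fastforce
    have "x f = 0" if "f \<in> edges G" for f
      using that kernel_edge_at[OF _ _ x(2)] \<open>x e = 0\<close> by (auto elim!: edge_cases)
    then show "x = 0"
      using x(1) F by (auto simp: fun_eq_iff)
  qed
qed

section \<open>Circles through two paths, and the vertex of large degree\<close>

text \<open>Go from \<open>v\<close> to \<open>e\<close> along path \<open>j\<close> and back along
  path \<open>l\<close>; \<open>tl\<close> removes the second copy of \<open>e\<close>.\<close>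

lemma hcircle_two_paths:
  assumes "j < m" "l < m" "j \<noteq> l"
  shows "hcircle G (A j @ tl (rev (A l))) (J j @ rev (J l))"
proof -
  have ne: "A j \<noteq> []" "A l \<noteq> []"
    using length_A assms by fastforce+
  have A: "A j = Inl v # tl (A j)" "A l = butlast (A l) @ [Inr e]"
    using ne hd_A last_A assms by (metis list.collapse, metis append_butlast_last_id)
  have tl: "tl (rev (A l)) = rev (butlast (A l))"
    by (metis A(2) rev.simps(2) rev_append rev_rev_ident append_Cons append_Nil list.sel(3))
  have ne': "butlast (A l) \<noteq> []"
    using length_A[OF assms(2)] by (simp flip: length_0_conv)
  moreover have "hd (butlast (A l)) = Inl v"
    using ne' A(2) hd_A[OF assms(2)] by (metis hd_append2)
  ultimately have lastv: "last (tl (rev (A l))) = Inl v"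
    unfolding tl by (simp add: last_rev)
  have "Inl v \<notin> set (tl (A j))" "Inr e \<notin> set (butlast (A l))"
    using distinct_A[OF assms(1)] distinct_A[OF assms(2)] A by (metis distinct.simps(2),
      metis distinct_append disjoint_insert(1) list.set(2))
  moreover have "set (tl (A j)) \<inter> set (butlast (A l)) \<subseteq> {Inl v, Inr e}"
    using A_disjoint[OF assms] by (auto dest: in_set_butlastD list.set_sel(2)[OF ne(1)])
  \<comment> \<open>The two common nodes are excluded: \<open>v\<close> from the first list,
    \<open>e\<close> from the second.\<close>
  ultimately have "set (tl (A j)) \<inter> set (butlast (A l)) = {}"
    by blast
  moreover have "distinct (tl (A j))" "distinct (butlast (A l))"
    using distinct_A assms by (auto intro: distinct_tl distinct_butlast)
  ultimately have "distinct (tl (A j @ tl (rev (A l))))"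
    using ne tl by simp
  moreover have "distinct (J j @ rev (J l))"
    using distinct_J J_disjoint assms by simp
  moreover have "hwalk G (A j @ tl (rev (A l))) (J j @ rev (J l))"
    using hwalk last_A assms ne by (intro hwalk_append hwalk_rev) (auto simp: hd_rev)
  moreover have "hd (A j @ tl (rev (A l))) = last (A j @ tl (rev (A l)))"
    using hd_A[OF assms(1)] ne lastv ne' tl by simp
  moreover have "J j \<noteq> []"
    using length_J[OF assms(1)] by auto
  ultimately show ?thesis
    by (simp add: hcircle_def)
qed

lemma circle_sign_two_paths:
  assumes "j < m" "l < m"
  shows "circle_sign G (J j @ rev (J l)) =
    - (orient G (J j ! 0) * tail_sign j 0 * (orient G (J l ! 0) * tail_sign l 0))"
proof -
  \<comment> \<open>Splitting off the first incidence leaves exactly the product in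
    \<open>tail_sign j 0\<close>.\<close>
  have *: "(-1) ^ half j * (\<Prod>i\<leftarrow>J j. orient G i) = orient G (J j ! 0) * tail_sign j 0" if "j < m" for j
  proof -
    have "(\<Prod>i\<leftarrow>J j. orient G i) = (\<Prod>q\<in>{0..<length (J j)}. orient G (J j ! q))"
      by (simp add: prod.list_conv_set_nth)
    also have "{0..<length (J j)} = insert 0 {1..<length (J j)}"
      using length_J[OF that] by auto
    finally show ?thesis by (simp add: tail_sign_def)
  qed
  \<comment> \<open>Two odd lengths contribute one extra unit to the half-length, whence the minus
    sign in the claim.\<close>
  have "length (J j @ rev (J l)) div 2 = Suc (half j + half l)"
    using assms length_J by simp
  then have "circle_sign G (J j @ rev (J l)) =
    - (((-1) ^ half j * (\<Prod>i\<leftarrow>J j. orient G i)) * ((-1) ^ half l * (\<Prod>i\<leftarrow>J l. orient G i)))"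
    by (simp add: circle_sign_def power_add prod_list.rev rev_map[symmetric])
  then show ?thesis using * assms by simp
qed

text \<open>Used to recognise the vertex of the original \<open>L\<close> inside
  \<open>G\<close>.\<close>

lemma v_if_degree:
  assumes "w \<in> verts G" "2 < card {i \<in> incs G. fst (inc_fun G i) = w}"
  shows "w = v"
  using assms(1)
proof (cases rule: vert_cases)
  case (2 j t)
  have "card {J j ! (2 * t + 1), J j ! (2 * t + 2)} \<le> 2"
    by (simp add: card_insert_if)
  then show ?thesis
    using assms(2) incs_at_inner[OF 2] by simp
qed

end

section \<open>Subdivisions and the conclusion\<close>

text \<open>Each subdivision puts its two new incidences at a new vertex, so old vertices keep their
  incidences. Old incidences may change their edge, hence only \<open>fst\<close> is
  tracked.\<close>

lemma subdivision_invariants: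
  assumes "subdivision H G" "oriented_hypergraph H"
  shows "verts H \<subseteq> verts G \<and> incs H \<subseteq> incs G \<and>
    (\<forall>i\<in>incs H. orient G i = orient H i \<and> fst (inc_fun G i) = fst (inc_fun H i)) \<and>
    (\<forall>i\<in>incs G - incs H. fst (inc_fun G i) \<notin> verts H)"
  using assms(1) unfolding subdivision_def
proof (induction rule: rtranclp_induct)
  case base
  then show ?case by simp
next
  case (step G G')
  from step(2) obtain w j1 j2 where *: "w \<notin> verts G" "verts G' = insert w (verts G)"
    "incs G' = insert j1 (insert j2 (incs G))"
    "fst (inc_fun G' j1) = w" "fst (inc_fun G' j2) = w"
    "\<forall>i \<in> incs G. orient G' i = orient G i"
    "\<forall>i \<in> incs G. fst (inc_fun G' i) = fst (inc_fun G i)"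
    unfolding edge_subdivision_def by (metis fst_conv)
  with step(3) show ?case by auto
qed

theorem corollary4p1p5:
  fixes k :: nat and G H :: "('v, 'e, 'i) ohypergraph"
  assumes "k > 0" and "2 * k \<ge> 3"
    and "oriented_hypergraph G"
    and "minimal_cross_theta (2 * k) G"
    and "is_L (2 * k) H" and "card (entrant H) = k" and "card (salient H) = k"
    and "balanced_subdivision H G"
  shows "minimally_dependent TYPE('k::field) G"
proof -
  obtain A J where AJ: "cross_theta_paths G (2 * k) A J"
    "Inl ` verts G \<union> Inr ` edges G = (\<Union>j<2 * k. set (A j))" "incs G = (\<Union>j<2 * k. set (J j))"
    using assms(4) by (auto simp: minimal_cross_theta_def)
  then obtain v e where
    "\<forall>j<2 * k. hpath G (A j) (J j) \<and> odd (length (J j)) \<and> hd (A j) = Inl v \<and> last (A j) = Inr e"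
    "\<forall>j<2 * k. \<forall>l<2 * k. j \<noteq> l \<longrightarrow>
      set (A j) \<inter> set (A l) = {Inl v, Inr e} \<and> set (J j) \<inter> set (J l) = {}"
    unfolding cross_theta_paths_def by blast
  with AJ assms(2,3) interpret cross_theta G "2 * k" A J v e
    by unfold_locales simp_all
  have H: "oriented_hypergraph H" "card (incs H) = 2 * k" "finite (incs H)"
    using assms(5) by (auto simp: is_L_def oriented_hypergraph_def)
  obtain v0 e0 where v0: "verts H = {v0}" "edges H = {e0}"
    using assms(5) by (auto simp: is_L_def card_1_singleton_iff)
  then have inc_H: "inc_fun H i = (v0, e0)" if "i \<in> incs H" for i
    using H(1) that by (fastforce simp: oriented_hypergraph_def)
  have bal: "circle_sign G is' = circle_sign H is"
    if "hcircle H as is" "hcircle G as' is'" "set is' \<inter> incs H = set is" for as "is" as' is'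
    using assms(8) that by (auto simp: balanced_subdivision_def)
  have sub: "v0 \<in> verts G" "incs H \<subseteq> incs G"
    "\<And>i. i \<in> incs H \<Longrightarrow> orient G i = orient H i \<and> fst (inc_fun G i) = v0"
    "\<And>i. i \<in> incs G \<Longrightarrow> i \<notin> incs H \<Longrightarrow> fst (inc_fun G i) \<noteq> v0"
    using subdivision_invariants[of H G] assms(8) H(1) v0 inc_H
    by (auto simp: balanced_subdivision_def)
  have incs_H: "incs H = {i \<in> incs G. fst (inc_fun G i) = v0}"
    using sub by blast
  \<comment> \<open>In \<open>G\<close> the vertex \<open>v0\<close> still has degree
    \<open>2 * k\<close>, which is at least 3.\<close>
  with H(2) assms(2) sub(1) have "v0 = v"
    by (intro v_if_degree) auto
  with incs_H have incs_H_J: "incs H = (\<lambda>j. J j ! 0) ` {..<2 * k}"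
    using incs_at_v by simp
  have J_Int: "set (J j) \<inter> incs H = {J j ! 0}" if "j < 2 * k" for j
  proof -
    have "J j ! q \<in> incs H \<longleftrightarrow> q = 0" if "q < length (J j)" for q
      using fst_J_eq_v_iff J_in_incs that \<open>j < 2 * k\<close> \<open>v0 = v\<close> by (simp add: incs_H)
    then show ?thesis
      using length_J[OF that] by (auto simp: in_set_conv_nth)
  qed
  \<comment> \<open>Balance is applied to the circle through paths \<open>j\<close> and 0, path 0
    serving as reference.\<close>
  have tail_eq: "tail_sign j 0 = tail_sign 0 0" if j: "j < 2 * k" for j
  proof (cases "j = 0")
    case False
    have 0: "0 < 2 * k" using j by simp
    let ?a = "J j ! 0" and ?b = "J 0 ! 0"
    have ab: "?a \<in> incs H" "?b \<in> incs H" "?a \<noteq> ?b"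
      using incs_H_J j 0 False inj_on_eq_iff[OF inj_on_J_0, of j 0] by auto
    have "hcircle H [Inl v0, Inr e0, Inl v0] [?a, ?b]"
      using ab inc_H v0 by (auto simp: hcircle_def hwalk_def less_Suc_eq)
    moreover have "hcircle G (A j @ tl (rev (A 0))) (J j @ rev (J 0))"
      using hcircle_two_paths j 0 False by blast
    moreover have "set (J j @ rev (J 0)) \<inter> incs H = set [?a, ?b]"
      using J_Int[OF j] J_Int[OF 0] by auto
    ultimately have "circle_sign G (J j @ rev (J 0)) = circle_sign H [?a, ?b]"
      by (rule bal)
    \<comment> \<open>The circle in \<open>H\<close> has two incidences, so its sign also carries
      one factor -1, which cancels.\<close>
    then have "orient G ?a * tail_sign j 0 * (orient G ?b * tail_sign 0 0) = orient G ?a * orient G ?b"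
      using circle_sign_two_paths[OF j 0] sub(3) ab by (simp add: circle_sign_def)
    moreover have "orient G ?a \<in> {1, -1}" "orient G ?b \<in> {1, -1}"
      using orient_J j 0 length_J by auto
    ultimately show ?thesis
      using tail_sign_cases[OF j, of 0] tail_sign_cases[OF 0, of 0] by auto
  qed simp
  have "(\<Sum>i\<in>incs H. orient H i) = (\<Sum>i\<in>entrant H \<union> salient H. orient H i)"
    using H(1) by (intro sum.cong) (auto simp: entrant_def salient_def oriented_hypergraph_def)
  also have "\<dots> = (\<Sum>i\<in>entrant H. orient H i) + (\<Sum>i\<in>salient H. orient H i)"
    using H(3) by (intro sum.union_disjoint) (auto simp: entrant_def salient_def)
  also have "\<dots> = 0"
    using assms(6,7) by (simp add: entrant_def salient_def)
  finally have "(\<Sum>i\<in>incs H. orient G i) = 0"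
    using sub(3) by simp
  then have "(\<Sum>j<2 * k. orient G (J j ! 0)) = 0"
    unfolding incs_H_J by (simp add: sum.reindex[OF inj_on_J_0])
  \<comment> \<open>The tail sign is the same on all paths and factors out of the row of
    \<open>v\<close>.\<close>
  moreover have "(\<Sum>j<2 * k. orient G (J j ! 0) * tail_sign j 0) =
      (\<Sum>j<2 * k. orient G (J j ! 0)) * tail_sign 0 0"
    unfolding sum_distrib_right by (intro sum.cong refl) (metis lessThan_iff tail_eq)
  ultimately have "(\<Sum>j<2 * k. orient G (J j ! 0) * tail_sign j 0) = 0"
    by simp
  then show ?thesis by (rule minimally_dependent)
qed

end
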